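(* Let $p \geq 0$ and $q \geq 2$ be integers, and let $G$ be a finite simple $r$-regular graph with $r$ odd and $r \geq \max\left\{3, \frac{17(p+1)}{16}\right\}$. Then \[ \alpha_p(G) \leq \alpha_q(L(G)). \]
   Context: For a graph $G$ and a non-negative integer $p$, a set $S \subseteq V(G)$ is $p$-independent if the subgraph induced by $S$ has maximum degree at most $p$; $\alpha_p(G)$ denotes the maximum cardinality of a $p$-independent set of $G$. $L(G)$ is the line graph of $G$. *)

theory Defs
  imports Complex_Main "HOL-Library.Ramsey"
begin

text \<open>
  A graph is given by its vertex set \<open>V\<close> and its set \<open>E\<close> of edges, an edge being a
  two-element set of vertices.
\<close>

definition fin_simple_graph :: "'a set \<Rightarrow> 'a set set \<Rightarrow> bool" where
  "fin_simple_graph V E \<longleftrightarrow> finite V \<and> E \<subseteq> [V]\<^bsup>2\<^esup>"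

definition degree :: "'a set set \<Rightarrow> 'a \<Rightarrow> nat" where
  "degree E v = card {e \<in> E. v \<in> e}"

definition regular :: "'a set \<Rightarrow> 'a set set \<Rightarrow> nat \<Rightarrow> bool" where
  "regular V E r \<longleftrightarrow> (\<forall>v \<in> V. degree E v = r)"

text \<open>Inserting \<open>0\<close> makes the maximum degree of the graph without vertices equal to \<open>0\<close>.\<close>

definition max_degree :: "'a set \<Rightarrow> 'a set set \<Rightarrow> nat" where
  "max_degree V E = Max (insert 0 (degree E ` V))"

definition induced_edges :: "'a set set \<Rightarrow> 'a set \<Rightarrow> 'a set set" where
  "induced_edges E S = {e \<in> E. e \<subseteq> S}"

definition p_independent :: "nat \<Rightarrow> 'a set \<Rightarrow> 'a set set \<Rightarrow> 'a set \<Rightarrow> bool" where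
  "p_independent p V E S \<longleftrightarrow> S \<subseteq> V \<and> max_degree S (induced_edges E S) \<le> p"

definition alpha :: "nat \<Rightarrow> 'a set \<Rightarrow> 'a set set \<Rightarrow> nat" where
  "alpha p V E = Max {card S | S. p_independent p V E S}"

text \<open>The line graph of \<open>(V, E)\<close> has vertex set \<open>E\<close> and edge set \<open>line_edges E\<close>.\<close>

definition line_edges :: "'a set set \<Rightarrow> 'a set set set" where
  "line_edges E = {{e, f} | e f. e \<in> E \<and> f \<in> E \<and> e \<noteq> f \<and> e \<inter> f \<noteq> {}}"

lemma fin_simple_graph_line_graph:
  assumes "fin_simple_graph V E"
  shows "fin_simple_graph E (line_edges E)"
proof -
  have "finite E"
    using assms finite_imp_finite_nsets finite_subset
    unfolding fin_simple_graph_def by blast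
  then show ?thesis
    by (auto simp: fin_simple_graph_def line_edges_def)
qed

text \<open>The maximum in the definition of \<open>alpha\<close> is attained.\<close>

lemma alpha_attained:
  assumes "finite V"
  shows "\<exists>S. p_independent p V E S \<and> card S = alpha p V E"
proof -
  let ?C = "{card S | S. p_independent p V E S}"
  have "?C \<subseteq> card ` Pow V"
    by (auto simp: p_independent_def)
  then have "finite ?C"
    using assms finite_subset by blast
  moreover have "p_independent p V E {}"
    by (simp add: p_independent_def max_degree_def)
  then have "?C \<noteq> {}"
    by blast
  ultimately have "Max ?C \<in> ?C"
    by (rule Max_in)
  then show ?thesis
    unfolding alpha_def by force
qed

end

theory Submission
  imports Defs "HOL-Library.Multiset"
begin

text \<open>
  The hypotheses give \<open>p < r\<close>. Counting the edges that leave a \<open>p\<close>-independent set \<open>S\<close> gives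
  \<open>|S| \<le> r (|V| - |S|)\<close>, so \<open>(r + 1) |S| \<le> r |V|\<close>. Conversely, write \<open>r + 1 = 2 d\<close>. Orient \<open>E\<close> so
  that in- and out-degrees differ by at most \<open>1\<close> and hence are at most \<open>d\<close>. Read as a bipartite
  graph between tails and heads, the arcs have a proper colouring with \<open>d\<close> colours (Koenig), so
  \<open>E\<close> is covered by \<open>d\<close> subgraphs of maximum degree at most \<open>2\<close>. The largest of them has at least
  \<open>|E| / d = r |V| / (r + 1)\<close> edges, and it is \<open>2\<close>-independent in the line graph.
\<close>

section \<open>Balanced orientations of multigraphs with loops\<close>

abbreviation und :: "'a \<times> 'a \<Rightarrow> 'a set" where
  "und e \<equiv> {fst e, snd e}"

text \<open>The two counts are the out-degree and the in-degree of \<open>v\<close>; a loop adds one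
  to each.\<close>

abbreviation balanced :: "('a \<times> 'a) multiset \<Rightarrow> bool" where
  "balanced D \<equiv> (\<forall>v. count (image_mset fst D) v \<le> count (image_mset snd D) v + 1 \<and>
    count (image_mset snd D) v \<le> count (image_mset fst D) v + 1)"

text \<open>Replacing the edges \<open>ab\<close> and \<open>bc\<close> by \<open>ac\<close> can create loops and parallel edges, which is why
  orientations are multisets of arcs with loops allowed.\<close>

lemma split_off_orientation:
  assumes "image_mset und D = add_mset {a, c} N" and "balanced D"
  shows "\<exists>D'. image_mset und D' = add_mset {a, b} (add_mset {b, c} N) \<and> balanced D'"
proof -
  have "{a, c} \<in># image_mset und D"
    using assms(1) by simp
  then obtain x y where xy: "(x, y) \<in># D" "{x, y} = {a, c}"
    by auto
  then obtain D2 where D2: "D = add_mset (x, y) D2"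
    by (meson mset_add)
  with assms(1) xy have N: "image_mset und D2 = N"
    by simp
  from xy(2) have "x = a \<and> y = c \<or> x = c \<and> y = a"
    by (auto simp: doubleton_eq_iff)
  then have "image_mset und (add_mset (x, b) (add_mset (b, y) D2)) = add_mset {a, b} (add_mset {b, c} N)"
    using N by (auto simp: insert_commute add_mset_commute)
  \<comment> \<open>Routing the arc from \<open>x\<close> to \<open>y\<close> through
    \<open>b\<close> keeps its contributions at \<open>x\<close> and \<open>y\<close> and adds one
    to both counts at \<open>b\<close>.\<close>
  moreover have "balanced (add_mset (x, b) (add_mset (b, y) D2))"
  proof
    fix v
    show "count (image_mset fst (add_mset (x, b) (add_mset (b, y) D2))) v
        \<le> count (image_mset snd (add_mset (x, b) (add_mset (b, y) D2))) v + 1 \<and>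
      count (image_mset snd (add_mset (x, b) (add_mset (b, y) D2))) v
        \<le> count (image_mset fst (add_mset (x, b) (add_mset (b, y) D2))) v + 1"
      using spec[OF assms(2), of v] unfolding D2 by (auto split: if_splits)
  qed
  ultimately show ?thesis
    by blast
qed

text \<open>Induction on the number of edges: two edges with a common vertex are split off into one.
  A loop never disturbs the balance, and an edge that meets no other edge may point either
  way.\<close>

lemma balanced_orientation:
  "\<exists>D. image_mset und D = image_mset und M \<and> balanced D"
proof (induction "size M" arbitrary: M rule: less_induct)
  case less
  have split: ?case
    if "image_mset und M = add_mset {a, b} (add_mset {b, c} (image_mset und M2))" for a b c M2
  proof -
    have "size (image_mset und M) = size M2 + 2"
      unfolding that by simp
    then obtain D where "image_mset und D = image_mset und (add_mset (a, c) M2)" "balanced D"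
      using less(1)[of "add_mset (a, c) M2"] by auto
    then show ?thesis
      using split_off_orientation[of D a c "image_mset und M2" b] that by auto
  qed
  show ?case
  proof (cases M)
    case empty
    then show ?thesis
      by (intro exI[of _ "{#}"]) simp
  next
    case (add e M1)
    obtain a b where e: "e = (a, b)"
      by force
    obtain D1 where D1: "image_mset und D1 = image_mset und M1" "balanced D1"
      using less(1)[of M1] add by auto
    have D: "image_mset und (add_mset e D1) = image_mset und M"
      using D1 add by simp
    consider (loop) "a = b" | (adj) f where "f \<in># M1" "a \<in> und f \<or> b \<in> und f"
      | (iso) "a \<noteq> b" "\<And>f. f \<in># M1 \<Longrightarrow> a \<notin> und f \<and> b \<notin> und f"
      by blast
    then show ?thesis
    proof cases
      case loop
      then show ?thesis
        using D1(2) D e by (intro exI[of _ "add_mset e D1"]) simp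
    next
      case adj
      obtain M2 where M2: "M1 = add_mset f M2"
        using adj(1) by (meson mset_add)
      from adj(2) show ?thesis
      proof
        assume "a \<in> und f"
        then obtain c where "und f = {a, c}"
          by (metis empty_iff insert_commute insert_iff)
        then show ?thesis
          using add e M2 by (intro split[of b a c M2]) (simp add: insert_commute)
      next
        assume "b \<in> und f"
        then obtain c where "und f = {b, c}"
          by (metis empty_iff insert_commute insert_iff)
        then show ?thesis
          using add e M2 by (intro split[of a b c M2]) simp
      qed
    next
      case iso
      have "a \<notin> und f \<and> b \<notin> und f" if "f \<in># D1" for f
      proof -
        have "und f \<in># image_mset und M1"
          using that by (simp flip: D1(1))
        then show ?thesis
          using iso(2) by auto
      qed
      \<comment> \<open>Both ends have in- and out-degree 0 in \<open>D1\<close>, so the single new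
        arc creates an imbalance of exactly 1.\<close>
      then have "a \<notin># image_mset fst D1" "a \<notin># image_mset snd D1"
        "b \<notin># image_mset fst D1" "b \<notin># image_mset snd D1"
        by force+
      then have "count (image_mset fst D1) a = 0" "count (image_mset snd D1) a = 0"
        "count (image_mset fst D1) b = 0" "count (image_mset snd D1) b = 0"
        by (simp_all only: not_in_iff)
      then have "balanced (add_mset e D1)"
        using D1(2) e iso(1) by auto
      then show ?thesis
        using D by blast
    qed
  qed
qed

section \<open>Koenig's edge colouring theorem for bipartite graphs\<close>

text \<open>Tails and heads are the two sides of a bipartite graph, hence the two types. Arcs that
  meet only as head of one and tail of the other may share a colour.\<close>

definition proper_arc_colouring :: "('a \<times> 'b) set \<Rightarrow> ('a \<times> 'b \<Rightarrow> nat) \<Rightarrow> bool" where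
  "proper_arc_colouring A c \<longleftrightarrow>
    (\<forall>e\<in>A. \<forall>f\<in>A. e \<noteq> f \<longrightarrow> fst e = fst f \<or> snd e = snd f \<longrightarrow> c e \<noteq> c f)"

lemma proper_arc_colouringD:
  assumes "proper_arc_colouring A c" "e \<in> A" "f \<in> A" "c e = c f" "fst e = fst f \<or> snd e = snd f"
  shows "e = f"
  using assms unfolding proper_arc_colouring_def by blast

text \<open>The tails on the \<open>\<alpha>\<close>-\<open>\<beta>\<close> chain that starts with the \<open>\<alpha>\<close>-arc into the head \<open>v\<close>. By parity, each of
  them has an outgoing \<open>\<alpha>\<close>-arc, so the chain misses every tail without one.\<close>

inductive_set kempe :: "('a \<times> 'b) set \<Rightarrow> ('a \<times> 'b \<Rightarrow> nat) \<Rightarrow> nat \<Rightarrow> nat \<Rightarrow> 'b \<Rightarrow> 'a set"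
  for A c \<alpha> \<beta> v where
  base: "(x, v) \<in> A \<Longrightarrow> c (x, v) = \<alpha> \<Longrightarrow> x \<in> kempe A c \<alpha> \<beta> v"
| step: "x \<in> kempe A c \<alpha> \<beta> v \<Longrightarrow> (x, w) \<in> A \<Longrightarrow> c (x, w) = \<beta> \<Longrightarrow>
    (y, w) \<in> A \<Longrightarrow> c (y, w) = \<alpha> \<Longrightarrow> y \<in> kempe A c \<alpha> \<beta> v"

text \<open>Frees one common colour \<alpha> at the tail \<open>u\<close> and the head
  \<open>v\<close>, so that an arc from \<open>u\<close> to \<open>v\<close> can receive it.\<close>

lemma kempe_swap:
  assumes proper: "proper_arc_colouring A c" and "\<alpha> \<noteq> \<beta>"
    and u: "\<And>w. (u, w) \<in> A \<Longrightarrow> c (u, w) \<noteq> \<alpha>"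
    and v: "\<And>x. (x, v) \<in> A \<Longrightarrow> c (x, v) \<noteq> \<beta>"
  obtains c' where "proper_arc_colouring A c'" "c' ` A \<subseteq> c ` A \<union> {\<alpha>, \<beta>}"
    "\<And>w. (u, w) \<in> A \<Longrightarrow> c' (u, w) \<noteq> \<alpha>" "\<And>x. (x, v) \<in> A \<Longrightarrow> c' (x, v) \<noteq> \<alpha>"
proof
  let ?X = "kempe A c \<alpha> \<beta> v"
  \<comment> \<open>Whether an arc is recoloured depends on its tail only, so both colours are
    exchanged at once at each tail; conflicts could arise only at heads, where \<open>closed\<close>
    excludes them.\<close>
  define c' where "c' e = (if fst e \<in> ?X \<and> c e = \<alpha> then \<beta> else if fst e \<in> ?X \<and> c e = \<beta> then \<alpha> else c e)" for e
  have tail: "\<exists>w. (x, w) \<in> A \<and> c (x, w) = \<alpha> \<and>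
      (w = v \<or> (\<exists>y\<in>?X. (y, w) \<in> A \<and> c (y, w) = \<beta>))" if "x \<in> ?X" for x
    using that by cases auto
  have uX: "u \<notin> ?X"
    using tail u by blast
  have closed: "x \<in> ?X \<longleftrightarrow> y \<in> ?X"
    if "(x, w) \<in> A" "(y, w) \<in> A" "c (x, w) = \<alpha>" "c (y, w) = \<beta>" for x y w
  proof
    assume "y \<in> ?X"
    then show "x \<in> ?X"
      using that by (blast intro: kempe.step)
  next
    assume "x \<in> ?X"
    then obtain w' where w': "(x, w') \<in> A" "c (x, w') = \<alpha>"
      "w' = v \<or> (\<exists>y\<in>?X. (y, w') \<in> A \<and> c (y, w') = \<beta>)"
      using tail by blast
    have "w' = w"
      using proper_arc_colouringD[OF proper that(1) w'(1)] that w' by simp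
    \<comment> \<open>The chain does not start at \<open>w\<close>: the \<beta>-arc from
      \<open>y\<close> rules out \<open>w = v\<close>. So \<open>w\<close> was entered along a
      \<beta>-arc, which properness identifies with the one from \<open>y\<close>.\<close>
    with w' v that obtain y' where y': "y' \<in> ?X" "(y', w) \<in> A" "c (y', w) = \<beta>"
      by blast
    then show "y \<in> ?X"
      using proper_arc_colouringD[OF proper that(2) y'(2)] that by simp
  qed
  show "proper_arc_colouring A c'"
    unfolding proper_arc_colouring_def
  proof (intro ballI impI notI)
    fix e f
    assume ef: "e \<in> A" "f \<in> A" "e \<noteq> f" "fst e = fst f \<or> snd e = snd f" "c' e = c' f"
    have ne: "c e \<noteq> c f"
      using proper_arc_colouringD[OF proper] ef by blast
    from ef(4) show False
    proof
      assume "fst e = fst f"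
      then show False
        using ne ef(5) \<open>\<alpha> \<noteq> \<beta>\<close> unfolding c'_def by (auto split: if_splits)
    next
      assume s: "snd e = snd f"
      then have "c e = \<alpha> \<Longrightarrow> c f = \<beta> \<Longrightarrow> fst e \<in> ?X \<longleftrightarrow> fst f \<in> ?X"
        "c f = \<alpha> \<Longrightarrow> c e = \<beta> \<Longrightarrow> fst e \<in> ?X \<longleftrightarrow> fst f \<in> ?X"
        using closed[of "fst e" "snd e" "fst f"] closed[of "fst f" "snd e" "fst e"] ef(1,2)
        by (metis prod.collapse)+
      then show False
        using ne ef(5) \<open>\<alpha> \<noteq> \<beta>\<close> unfolding c'_def by (auto split: if_splits)
    qed
  qed
  show "c' ` A \<subseteq> c ` A \<union> {\<alpha>, \<beta>}"
    unfolding c'_def by auto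
  show "c' (u, w) \<noteq> \<alpha>" if "(u, w) \<in> A" for w
    using uX u[OF that] unfolding c'_def by auto
  show "c' (x, v) \<noteq> \<alpha>" if "(x, v) \<in> A" for x
    using v[OF that] \<open>\<alpha> \<noteq> \<beta>\<close> kempe.base[OF that] unfolding c'_def by auto
qed

lemma missing_colour:
  assumes "finite B" "card B < d"
  obtains k :: nat where "k < d" "k \<notin> c ` B"
proof -
  have "card (c ` B) < card {..<d}"
    using card_image_le[OF assms(1), of c] assms(2) by simp
  then have "\<not> {..<d} \<subseteq> c ` B"
    using assms(1) card_mono[of "c ` B" "{..<d}"] by auto
  then show thesis
    using that by blast
qed

text \<open>Induction on the arcs. Before an arc is added, its tail and its head each miss a colour;
  if the two colours differ, a Kempe swap makes them agree.\<close>

lemma koenig_arc_colouring: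
  assumes "finite A"
    and "\<And>u. card {e \<in> A. fst e = u} \<le> d" and "\<And>v. card {e \<in> A. snd e = v} \<le> d"
  shows "\<exists>c. proper_arc_colouring A c \<and> c ` A \<subseteq> {..<d}"
  using assms
proof (induction A)
  case empty
  then show ?case
    by (simp add: proper_arc_colouring_def)
next
  case (insert e A)
  obtain u v where e: "e = (u, v)"
    by force
  have "card {f \<in> A. fst f = x} \<le> card {f \<in> insert e A. fst f = x}"
    "card {f \<in> A. snd f = y} \<le> card {f \<in> insert e A. snd f = y}" for x y
    using insert.hyps by (auto intro!: card_mono)
  then obtain c where c: "proper_arc_colouring A c" "c ` A \<subseteq> {..<d}"
    using insert.IH insert.prems by (meson le_trans)
  have "{f \<in> insert e A. fst f = u} = insert e {f \<in> A. fst f = u}"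
    "{f \<in> insert e A. snd f = v} = insert e {f \<in> A. snd f = v}"
    using e by auto
  then have less: "card {f \<in> A. fst f = u} < d" "card {f \<in> A. snd f = v} < d"
    using insert.hyps insert.prems(1)[of u] insert.prems(2)[of v] by simp_all
  obtain \<alpha> where \<alpha>: "\<alpha> < d" "\<alpha> \<notin> c ` {f \<in> A. fst f = u}"
    using missing_colour[OF _ less(1)] insert.hyps by auto
  obtain \<beta> where \<beta>: "\<beta> < d" "\<beta> \<notin> c ` {f \<in> A. snd f = v}"
    using missing_colour[OF _ less(2)] insert.hyps by auto
  have u: "\<And>w. (u, w) \<in> A \<Longrightarrow> c (u, w) \<noteq> \<alpha>" and v: "\<And>x. (x, v) \<in> A \<Longrightarrow> c (x, v) \<noteq> \<beta>"
    using \<alpha>(2) \<beta>(2) by force+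
  obtain c' where c': "proper_arc_colouring A c'" "c' ` A \<subseteq> {..<d}"
    "\<And>w. (u, w) \<in> A \<Longrightarrow> c' (u, w) \<noteq> \<alpha>" "\<And>x. (x, v) \<in> A \<Longrightarrow> c' (x, v) \<noteq> \<alpha>"
  proof (cases "\<alpha> = \<beta>")
    case True
    then show thesis
      using that[of c] c u v by blast
  next
    case False
    obtain c' where "proper_arc_colouring A c'" "c' ` A \<subseteq> c ` A \<union> {\<alpha>, \<beta>}"
      "\<And>w. (u, w) \<in> A \<Longrightarrow> c' (u, w) \<noteq> \<alpha>" "\<And>x. (x, v) \<in> A \<Longrightarrow> c' (x, v) \<noteq> \<alpha>"
      using kempe_swap[OF c(1) False u v] by metis
    then show thesis
      using that[of c'] c(2) \<alpha>(1) \<beta>(1) by blast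
  qed
  have "proper_arc_colouring (insert e A) (c'(e := \<alpha>))"
    using c'(1,3,4) insert.hyps(2) e unfolding proper_arc_colouring_def
    by (auto split: if_splits) metis+
  moreover have "(c'(e := \<alpha>)) ` insert e A \<subseteq> {..<d}"
    using c'(2) \<alpha>(1) by auto
  ultimately show ?case
    by blast
qed

section \<open>Covering a graph by subgraphs of maximum degree two\<close>

lemma card_set_mset_le_size: "card (set_mset D) \<le> size D"
  by (induction D) (auto simp: card_insert_if)

lemma card_filter_set_mset_le:
  "card {e \<in> set_mset D. f e = v} \<le> count (image_mset f D) v"
proof -
  have "card (set_mset (filter_mset (\<lambda>e. f e = v) D)) \<le> size (filter_mset (\<lambda>e. f e = v) D)"
    by (rule card_set_mset_le_size)
  moreover have "size (filter_mset (\<lambda>e. f e = v) D) = count (image_mset f D) v"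
    by (induction D) auto
  ultimately show ?thesis
    by simp
qed

text \<open>Loops are excluded because a loop at \<open>v\<close> counts once on the left and twice
  on the right.\<close>

lemma incident_eq_count_tail_head:
  assumes "\<forall>e\<in>#D. fst e \<noteq> snd e"
  shows "size (filter_mset (\<lambda>s. v \<in> s) (image_mset und D)) =
    count (image_mset fst D) v + count (image_mset snd D) v"
  using assms by (induction D) auto

lemma degree_two_cover:
  assumes fin: "finite E" and E: "\<And>e. e \<in> E \<Longrightarrow> card e = 2"
    and deg: "\<And>v. degree E v \<le> 2 * d"
  obtains F :: "nat \<Rightarrow> 'a set set"
    where "(\<Union>i<d. F i) = E" "\<And>i v. degree (F i) v \<le> 2"
proof -
  \<comment> \<open>An arbitrary orientation \<open>g\<close> presents \<open>E\<close> as a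
    multiset of arcs, to be rebalanced.\<close>
  have "\<exists>p. und p = e" if "e \<in> E" for e
    using E[OF that] by (auto simp: card_2_iff)
  then obtain g where g: "\<And>e. e \<in> E \<Longrightarrow> und (g e) = e"
    by metis
  have "image_mset und (image_mset g (mset_set E)) = image_mset id (mset_set E)"
    using g fin by (simp only: image_mset.compositionality) (rule image_mset_cong, simp)
  then obtain D where D: "image_mset und D = mset_set E" "balanced D"
    using balanced_orientation[of "image_mset g (mset_set E)"] by auto
  let ?A = "set_mset D"
  have img: "und ` ?A = E"
    using arg_cong[OF D(1), of set_mset] fin by simp
  have noloop: "fst e \<noteq> snd e" if "e \<in># D" for e
    using E[of "und e"] img that by auto
  have sum: "count (image_mset fst D) v + count (image_mset snd D) v \<le> 2 * d" for v
    using incident_eq_count_tail_head[of D v] noloop deg[of v] fin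
    unfolding D(1) degree_def by (simp add: filter_mset_mset_set)
  \<comment> \<open>If one count were at least \<open>d + 1\<close>, the other would be at least
    \<open>d\<close>, and the sum would exceed \<open>2 * d\<close>.\<close>
  have bnd: "count (image_mset fst D) v \<le> d" "count (image_mset snd D) v \<le> d" for v
    using spec[OF D(2), of v] sum[of v] by linarith+
  obtain c where c: "proper_arc_colouring ?A c" "c ` ?A \<subseteq> {..<d}"
    using koenig_arc_colouring[OF finite_set_mset le_trans[OF card_filter_set_mset_le bnd(1)]
        le_trans[OF card_filter_set_mset_le bnd(2)]]
    by blast
  define F where "F i = und ` {e \<in> ?A. c e = i}" for i
  have "(\<Union>i<d. F i) = E"
    using c(2) unfolding F_def img[symmetric] by auto
  moreover have "degree (F i) v \<le> 2" for i v
  proof -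
    let ?T = "{e \<in> ?A. c e = i \<and> fst e = v}" and ?H = "{e \<in> ?A. c e = i \<and> snd e = v}"
    have "{e \<in> F i. v \<in> e} \<subseteq> und ` (?T \<union> ?H)"
      unfolding F_def by auto
    then have "degree (F i) v \<le> card (?T \<union> ?H)"
      unfolding degree_def by (intro surj_card_le) auto
    also have "\<dots> \<le> card ?T + card ?H"
      by (rule card_Un_le)
    also have "card ?T \<le> 1"
      using proper_arc_colouringD[OF c(1)] by (auto simp: card_le_Suc0_iff_eq)
    also have "card ?H \<le> 1"
      using proper_arc_colouringD[OF c(1)] by (auto simp: card_le_Suc0_iff_eq)
    finally show ?thesis
      by simp
  qed
  ultimately show thesis
    using that by blast
qed

text \<open>Pigeonhole: some class of the cover has at least the average size.\<close>

lemma large_degree_two_subgraph: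
  assumes "finite E" "\<And>e. e \<in> E \<Longrightarrow> card e = 2" "\<And>v. degree E v \<le> 2 * d"
  obtains F where "F \<subseteq> E" "\<And>v. degree F v \<le> 2" "card E \<le> d * card F"
proof -
  obtain F :: "nat \<Rightarrow> 'a set set"
    where F: "(\<Union>i<d. F i) = E" "\<And>i v. degree (F i) v \<le> 2"
    using degree_two_cover[OF assms] by metis
  show thesis
  proof (cases "\<exists>i<d. card E \<le> d * card (F i)")
    case True
    then show thesis
      using that F by blast
  next
    case False
    \<comment> \<open>For \<open>d = 0\<close> there is no class to choose, but then
      \<open>E\<close> is empty and \<open>{}\<close> serves.\<close>
    show thesis
    proof (cases "E = {}")
      case True
      then show thesis
        using that[of "{}"] by (simp add: degree_def)
    next
      case ne: False
      then have "0 < d"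
        using F(1) by (cases d) auto
      have "card E \<le> (\<Sum>i<d. card (F i))"
        using card_UN_le[of "{..<d}" F] F(1) by simp
      then have "d * card E \<le> (\<Sum>i<d. d * card (F i))"
        by (simp flip: sum_distrib_left)
      also have "\<dots> < (\<Sum>i<d. card E)"
        using False \<open>0 < d\<close> by (intro sum_strict_mono) auto
      finally show thesis
        by simp
    qed
  qed
qed

section \<open>Independent sets in line graphs and in regular graphs\<close>

lemma max_degree_le_iff:
  "finite V \<Longrightarrow> max_degree V E \<le> k \<longleftrightarrow> (\<forall>v\<in>V. degree E v \<le> k)"
  by (simp add: max_degree_def)

lemma card_le_alpha:
  assumes "finite V" "p_independent p V E S"
  shows "card S \<le> alpha p V E"
proof -
  have "{card S | S. p_independent p V E S} \<subseteq> card ` Pow V"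
    by (auto simp: p_independent_def)
  then have "finite {card S | S. p_independent p V E S}"
    using assms(1) finite_subset by blast
  then show ?thesis
    using assms(2) unfolding alpha_def by (auto intro: Max_ge)
qed

text \<open>At each of its two ends, an edge of \<open>F\<close> meets at most one other edge of
  \<open>F\<close>.\<close>

lemma degree_two_independent_line_graph:
  assumes "finite E" "\<And>e. e \<in> E \<Longrightarrow> card e = 2" "F \<subseteq> E" "\<And>v. degree F v \<le> 2"
  shows "p_independent 2 E (line_edges E) F"
proof -
  have finF: "finite F"
    using assms finite_subset by blast
  have "degree (induced_edges (line_edges E) F) e \<le> 2" if e: "e \<in> F" for e
  proof -
    obtain x y where xy: "e = {x, y}"
      using assms(2)[of e] assms(3) e by (auto simp: card_2_iff)
    let ?I = "\<lambda>z. {f \<in> F. z \<in> f} - {e}"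
    have I: "card (?I z) \<le> 1" if "z \<in> e" for z
      using assms(4)[of z] e that finF unfolding degree_def by (subst card_Diff_singleton) auto
    have "{g \<in> induced_edges (line_edges E) F. e \<in> g} \<subseteq> (\<lambda>f. {e, f}) ` (?I x \<union> ?I y)"
      unfolding induced_edges_def line_edges_def xy by (auto simp: insert_commute)
    then have "degree (induced_edges (line_edges E) F) e \<le> card (?I x \<union> ?I y)"
      unfolding degree_def using finF by (intro surj_card_le) auto
    also have "\<dots> \<le> card (?I x) + card (?I y)"
      by (rule card_Un_le)
    also have "\<dots> \<le> 1 + 1"
      using I xy by (intro add_mono) auto
    finally show ?thesis
      by simp
  qed
  then show ?thesis
    using assms(3) finF by (simp add: p_independent_def max_degree_le_iff)
qed

lemma p_independent_mono:
  "p_independent p V E S \<Longrightarrow> p \<le> q \<Longrightarrow> p_independent q V E S"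
  by (auto simp: p_independent_def)

text \<open>Every vertex of \<open>S\<close> has an edge leaving \<open>S\<close>, and each such edge has only one end in \<open>S\<close>.\<close>

lemma regular_p_independent_card:
  assumes "fin_simple_graph V E" "regular V E r" "p < r" "p_independent p V E S"
  shows "card S * (r + 1) \<le> r * card V"
proof -
  have V: "finite V" and E: "\<And>e. e \<in> E \<Longrightarrow> e \<subseteq> V \<and> card e = 2"
    using assms(1) by (auto simp: fin_simple_graph_def nsets_def)
  have "finite E"
    using V E by (meson PowI finite_Pow_iff finite_subset subsetI)
  have S: "S \<subseteq> V" "finite S"
    using assms(4) V finite_subset by (auto simp: p_independent_def)
  define B where "B = {e \<in> E. \<not> e \<subseteq> S}"
  have "finite B"
    using \<open>finite E\<close> unfolding B_def by simp
  have "\<exists>e\<in>B. v \<in> e" if v: "v \<in> S" for v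
  proof (rule ccontr)
    assume "\<not> ?thesis"
    then have "{e \<in> E. v \<in> e} = {e \<in> induced_edges E S. v \<in> e}"
      unfolding B_def induced_edges_def by blast
    moreover have "degree (induced_edges E S) v \<le> p"
      using assms(4) v S by (simp add: p_independent_def max_degree_le_iff)
    ultimately have "degree E v \<le> p"
      by (simp add: degree_def)
    then show False
      using assms(2,3) v S(1) by (auto simp: regular_def)
  qed
  then obtain f where f: "\<And>v. v \<in> S \<Longrightarrow> f v \<in> B \<and> v \<in> f v"
    by metis
  have "inj_on f S"
  proof (rule inj_onI, rule ccontr)
    fix v w
    assume vw: "v \<in> S" "w \<in> S" "f v = f w" "v \<noteq> w"
    then have "{v, w} \<subseteq> f v" "card (f v) = 2"
      using f[of v] f[of w] E unfolding B_def by auto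
    then have "f v = {v, w}"
      using vw(4) by (auto simp: card_2_iff)
    then show False
      using f[of v] vw unfolding B_def by auto
  qed
  then have "card S \<le> card B"
    using card_inj_on_le[of f S B] f \<open>finite B\<close> by blast
  \<comment> \<open>Each edge of \<open>B\<close> has an end outside \<open>S\<close>, and each
    vertex there lies on \<open>r\<close> edges.\<close>
  also have "B \<subseteq> (\<Union>w\<in>V - S. {e \<in> E. w \<in> e})"
    using E unfolding B_def by blast
  then have "card B \<le> card (\<Union>w\<in>V - S. {e \<in> E. w \<in> e})"
    using V \<open>finite E\<close> by (intro card_mono) auto
  also have "\<dots> \<le> (\<Sum>w\<in>V - S. card {e \<in> E. w \<in> e})"
    using V by (intro card_UN_le) simp
  also have "\<dots> = (\<Sum>w\<in>V - S. r)"
    using assms(2) by (intro sum.cong) (auto simp: regular_def degree_def)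
  also have "\<dots> = r * (card V - card S)"
    using S V by (simp add: card_Diff_subset mult.commute)
  finally have "card S \<le> r * card V - r * card S"
    by (simp only: diff_mult_distrib2)
  \<comment> \<open>Subtraction on \<open>nat\<close> truncates, so this is needed to move the
    subtracted term across.\<close>
  moreover have "r * card S \<le> r * card V"
    using card_mono[OF V S(1)] by simp
  ultimately show ?thesis
    unfolding add_mult_distrib2 mult_1_right mult.commute[of "card S" r] by linarith
qed

lemma regular_handshake:
  assumes "fin_simple_graph V E" "regular V E r"
  shows "r * card V = 2 * card E"
proof -
  have V: "finite V" and E: "\<And>e. e \<in> E \<Longrightarrow> e \<subseteq> V \<and> card e = 2"
    using assms(1) by (auto simp: fin_simple_graph_def nsets_def)
  have "finite E"
    using V E by (meson PowI finite_Pow_iff finite_subset subsetI)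
  have "(\<Sum>v\<in>V. card {e \<in> E. v \<in> e}) = 2 * card E"
  proof (rule sum_multicount[OF V \<open>finite E\<close>], intro ballI)
    fix e assume "e \<in> E"
    then have "{v \<in> V. v \<in> e} = e"
      using E by blast
    then show "card {v \<in> V. v \<in> e} = 2"
      using E \<open>e \<in> E\<close> by simp
  qed
  then show ?thesis
    using assms(2) by (simp add: regular_def degree_def mult.commute)
qed

theorem theorem11:
  fixes V :: "'a set" and E :: "'a set set" and p q r :: nat
  assumes "q \<ge> 2"
    and "fin_simple_graph V E"
    and "regular V E r"
    and "odd r"
    and "real r \<ge> max 3 (17 * (real p + 1) / 16)"
  shows "alpha p V E \<le> alpha q E (line_edges E)"
proof -
  have E: "\<And>e. e \<in> E \<Longrightarrow> e \<subseteq> V \<and> card e = 2" and V: "finite V"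
    using assms(2) by (auto simp: fin_simple_graph_def nsets_def)
  have finE: "finite E"
    using fin_simple_graph_line_graph[OF assms(2)] by (simp add: fin_simple_graph_def)
  \<comment> \<open>This follows from \<open>17 * (p + 1) / 16 > p\<close>.\<close>
  have "p < r"
    using assms(5) by simp
  obtain k where r: "r = 2 * k + 1"
    using assms(4) by (auto elim: oddE)
  \<comment> \<open>Since \<open>r\<close> is odd, \<open>r + 1\<close> is an even degree bound, so
    \<open>k + 1\<close> classes suffice. The bound must also cover points outside \<open>V\<close>,
    whose degree is 0.\<close>
  have deg: "degree E v \<le> 2 * (k + 1)" for v
  proof (cases "v \<in> V")
    case True
    then show ?thesis
      using assms(3) r by (simp add: regular_def)
  next
    case False
    then have "{e \<in> E. v \<in> e} = {}"
      using E by blast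
    then have "degree E v = 0"
      unfolding degree_def by (simp only: card.empty)
    then show ?thesis
      by simp
  qed
  obtain F where F: "F \<subseteq> E" "\<And>v. degree F v \<le> 2" "card E \<le> (k + 1) * card F"
    using large_degree_two_subgraph[OF finE _ deg] E by metis
  obtain S where S: "p_independent p V E S" "card S = alpha p V E"
    using alpha_attained[OF V] by blast
  \<comment> \<open>Both sizes are compared through \<open>2 * card E\<close>, which equals
    \<open>r * card V\<close>; the common factor \<open>r + 1\<close> then cancels.\<close>
  have "card S * (r + 1) \<le> 2 * card E"
    using regular_p_independent_card[OF assms(2,3) \<open>p < r\<close> S(1)] regular_handshake[OF assms(2,3)]
    by simp
  also have "\<dots> \<le> card F * (r + 1)"
    using F(3) r by (simp add: algebra_simps)
  finally have "card S \<le> card F"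
    by (simp only: mult_le_cancel2)
  also have "p_independent q E (line_edges E) F"
    using p_independent_mono[OF degree_two_independent_line_graph[OF finE _ F(1,2)] assms(1)] E by simp
  then have "card F \<le> alpha q E (line_edges E)"
    by (rule card_le_alpha[OF finE])
  finally show ?thesis
    using S(2) by simp
qed

end
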